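(* Let $E$ be an Archimedean Riesz space with a strong unit $e>0$, equipped with the truncation $f^{\ast}=e\wedge f$ for all $f\in E^{+}$. Then $\eta E$ is compact and $E$ is Riesz isomorphic to a uniformly dense Riesz subspace of $C(\eta E)$ in such a way that $e$ is identified with the constant function $1$ on $\eta E$.
   Context: A Riesz space is a real vector lattice, with positive cone $E^{+}$. A positive element $e$ of a Riesz space $E$ is a strong unit if for every $f\in E$ there is $\varepsilon\in(0,\infty)$ with $|f|\le\varepsilon e$. A truncation on a Riesz space $E$ is a unary operation $\ast:E^{+}\to E^{+}$, $f\mapsto f^{\ast}$, such that $f^{\ast}\wedge g=f\wedge g^{\ast}$ for all $f,g\in E^{+}$. The spectrum $\eta E$ of a Riesz space $E$ with a truncation is the set of all nonzero Riesz homomorphisms (linear lattice homomorphisms) $u:E\to\mathbb{R}$ such that $u(f^{\ast})=\min\{1,u(f)\}$ for all $f\in E^{+}$, with the topology inherited from the product topology on $\mathbb{R}^{E}$. $C(\eta E)$ is the Riesz space of all continuous real-valued functions on $\eta E$ with the pointwise operations, and "uniformly dense" means dense for the uniform norm. *)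

theory Defs
  imports "HOL-Analysis.Analysis"
begin

class riesz_space = ordered_real_vector + lattice

instance real :: riesz_space ..

definition archimedean :: "'a::riesz_space itself \<Rightarrow> bool" where
  "archimedean _ \<longleftrightarrow>
     (\<forall>f g :: 'a. 0 \<le> f \<longrightarrow> 0 \<le> g \<longrightarrow> (\<forall>n::nat. real n *\<^sub>R f \<le> g) \<longrightarrow> f = 0)"

text \<open>The absolute value of a Riesz space is \<open>sup f (- f)\<close>; the class \<open>abs\<close> is not assumed.\<close>

definition strong_unit :: "'a::riesz_space \<Rightarrow> bool" where
  "strong_unit e \<longleftrightarrow> 0 \<le> e \<and> (\<forall>f. \<exists>\<epsilon>>0. sup f (- f) \<le> \<epsilon> *\<^sub>R e)"

text \<open>A truncation is a map on the positive cone; the values of \<open>t\<close> off the cone are irrelevant.\<close>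

definition truncation :: "('a::riesz_space \<Rightarrow> 'a) \<Rightarrow> bool" where
  "truncation t \<longleftrightarrow> t \<in> {0..} \<rightarrow> {0..} \<and> (\<forall>f\<ge>0. \<forall>g\<ge>0. inf (t f) g = inf f (t g))"

definition riesz_hom :: "('a::riesz_space \<Rightarrow> 'b::riesz_space) \<Rightarrow> bool" where
  "riesz_hom u \<longleftrightarrow> linear u \<and>
     (\<forall>f g. u (sup f g) = sup (u f) (u g)) \<and> (\<forall>f g. u (inf f g) = inf (u f) (u g))"

text \<open>The topology is the one of the ambient type \<^typ>\<open>'a \<Rightarrow> real\<close>, i.e. the product topology.\<close>

definition spectrum :: "('a::riesz_space \<Rightarrow> 'a) \<Rightarrow> ('a \<Rightarrow> real) set" where
  "spectrum t = {u. riesz_hom u \<and> u \<noteq> (\<lambda>_. 0) \<and> (\<forall>f\<ge>0. u (t f) = min 1 (u f))}"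

text \<open>Functions on a set \<open>X\<close> are represented extensionally (\<open>undefined\<close> off \<open>X\<close>), so that
  equality of representatives is equality of functions on \<open>X\<close>.\<close>

definition cont_funs :: "'b::topological_space set \<Rightarrow> ('b \<Rightarrow> real) set" where
  "cont_funs X = {\<phi> \<in> extensional X. continuous_on X \<phi>}"

definition riesz_subspace_of_cont_funs ::
    "'b::topological_space set \<Rightarrow> ('b \<Rightarrow> real) set \<Rightarrow> bool" where
  "riesz_subspace_of_cont_funs X S \<longleftrightarrow>
     S \<subseteq> cont_funs X \<and>
     (\<lambda>x\<in>X. 0) \<in> S \<and>
     (\<forall>\<phi>\<in>S. \<forall>\<psi>\<in>S. (\<lambda>x\<in>X. \<phi> x + \<psi> x) \<in> S) \<and>
     (\<forall>c. \<forall>\<phi>\<in>S. (\<lambda>x\<in>X. c * \<phi> x) \<in> S) \<and>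
     (\<forall>\<phi>\<in>S. \<forall>\<psi>\<in>S. (\<lambda>x\<in>X. max (\<phi> x) (\<psi> x)) \<in> S) \<and>
     (\<forall>\<phi>\<in>S. \<forall>\<psi>\<in>S. (\<lambda>x\<in>X. min (\<phi> x) (\<psi> x)) \<in> S)"

text \<open>\<^const>\<open>cfunspace\<close> carries the supremum distance on bounded continuous functions;
  for compact \<open>X\<close> its carrier is \<^term>\<open>cont_funs X\<close>.\<close>

definition uniformly_dense_in_cont_funs ::
    "'b::topological_space set \<Rightarrow> ('b \<Rightarrow> real) set \<Rightarrow> bool" where
  "uniformly_dense_in_cont_funs X S \<longleftrightarrow>
     cont_funs X \<subseteq> mtopology_of (cfunspace (top_of_set X) euclidean_metric) closure_of S"

definition riesz_iso_onto ::
    "'b set \<Rightarrow> ('a::riesz_space \<Rightarrow> 'b \<Rightarrow> real) \<Rightarrow> ('b \<Rightarrow> real) set \<Rightarrow> bool" where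
  "riesz_iso_onto X \<Phi> S \<longleftrightarrow>
     bij_betw \<Phi> UNIV S \<and>
     (\<forall>f g. \<Phi> (f + g) = (\<lambda>x\<in>X. \<Phi> f x + \<Phi> g x)) \<and>
     (\<forall>c f. \<Phi> (c *\<^sub>R f) = (\<lambda>x\<in>X. c * \<Phi> f x)) \<and>
     (\<forall>f g. \<Phi> (sup f g) = (\<lambda>x\<in>X. max (\<Phi> f x) (\<Phi> g x))) \<and>
     (\<forall>f g. \<Phi> (inf f g) = (\<lambda>x\<in>X. min (\<Phi> f x) (\<Phi> g x)))"

lemma truncation_inf:
  fixes e :: "'a::riesz_space"
  assumes "0 \<le> e"
  shows "truncation (\<lambda>f. inf e f)"
  using assms by (auto simp: truncation_def inf.assoc inf.left_commute)

lemma mspace_cfunspace_compact: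
  assumes "compact X"
  shows "mspace (cfunspace (top_of_set X) euclidean_metric) = cont_funs X"
  using assms by (subst compactin_mspace_cfunspace)
    (auto simp: cont_funs_def compactin_subtopology mtopology_of_euclidean)

end

theory Submission
  imports Defs
begin

text \<open>
  The points of the spectrum are the Riesz homomorphisms \<open>u\<close> with \<open>u e = 1\<close>, and the isomorphism
  sends \<open>f\<close> to the evaluation \<open>u \<mapsto> u f\<close>. Since \<open>\<bar>u f\<bar> \<le> \<epsilon>\<close> as soon as \<open>\<bar>f\<bar> \<le> \<epsilon> e\<close>, the
  spectrum is a closed subset of a product of compact intervals, hence compact by Tychonoff's
  theorem. Evaluations form a Riesz subspace of the continuous functions which contains the
  constants and separates the points, so it is dense by the lattice form of the
  Stone--Weierstrass theorem (\<open>lattice_stone_weierstrass\<close>).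

  The point that needs an argument is injectivity: for \<open>f \<noteq> 0\<close> there must be a Riesz homomorphism
  that does not vanish at \<open>f\<close>. A homomorphism \<open>u\<close> is determined by the set
  \<open>W = {g. u g \<le> 0}\<close>, which is a convex cone, is closed downwards and under suprema, and does not
  contain \<open>e\<close>. Call any set with these properties a nonpositivity cone. (The positive parts of its
  elements form the positive cone of a proper order ideal, so this is a one-sided description
  of such ideals which avoids absolute values and quotients.) By Zorn's lemma every nonpositivity
  cone lies in a maximal one, and a maximal one comes from a homomorphism
  (\<open>maximal_cone_induces_hom\<close>): \<open>u f\<close> is the least \<open>s\<close> with \<open>f - s e \<in> W\<close>. Finally, if \<open>s\<close> is the
  least number with \<open>\<bar>f\<bar> \<le> s e\<close>, which exists and is positive because the space is Archimedean, then
  the elements below some nonnegative multiple of \<open>s e - \<bar>f\<bar>\<close> form a nonpositivity cone, and a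
  homomorphism that comes from a maximal cone above it satisfies \<open>u \<bar>f\<bar> \<ge> s > 0\<close>.
\<close>

section \<open>Riesz space preliminaries\<close>

lemma sup_add_right:
  fixes f g h :: "'a::riesz_space"
  shows "sup f g + h = sup (f + h) (g + h)"
proof (rule order.antisym)
  have "f \<le> sup (f + h) (g + h) - h" "g \<le> sup (f + h) (g + h) - h"
    by (simp_all add: le_diff_eq)
  then show "sup f g + h \<le> sup (f + h) (g + h)"
    by (metis le_diff_eq sup_least)
qed simp

lemma uminus_sup:
  fixes f g :: "'a::riesz_space"
  shows "- sup f g = inf (- f) (- g)"
proof (rule order.antisym)
  have "sup f g \<le> - inf (- f) (- g)"
    by (metis inf_le1 inf_le2 le_minus_iff sup_least)
  then show "inf (- f) (- g) \<le> - sup f g"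
    by (simp add: le_minus_iff)
qed simp

lemma sup_uminus_eq_0_iff:
  fixes f :: "'a::riesz_space"
  shows "sup f (- f) \<le> 0 \<longleftrightarrow> f = 0"
  by (metis le_sup_iff neg_le_0_iff_le order.antisym order_refl neg_equal_zero minus_zero)

lemma scaleR_le_iff_of_pos:
  fixes e :: "'a::riesz_space"
  assumes "0 < e"
  shows "s *\<^sub>R e \<le> t *\<^sub>R e \<longleftrightarrow> s \<le> t"
proof
  assume le: "s *\<^sub>R e \<le> t *\<^sub>R e"
  show "s \<le> t"
  proof (rule ccontr)
    assume "\<not> s \<le> t"
    then have "0 < s - t" by simp
    have "(s - t) *\<^sub>R e \<le> 0"
      using le by (simp add: scaleR_left_diff_distrib)
    then have "(1 / (s - t)) *\<^sub>R ((s - t) *\<^sub>R e) \<le> (1 / (s - t)) *\<^sub>R 0"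
      using \<open>0 < s - t\<close> by (intro scaleR_left_mono) auto
    then show False
      using \<open>0 < s - t\<close> assms by simp
  qed
qed (use assms in \<open>auto intro: scaleR_right_mono\<close>)

text \<open>The sign of \<open>h\<close> is arbitrary here; the Archimedean axiom is applied to its positive part.\<close>

lemma archimedean_le_0:
  fixes e h :: "'a::riesz_space"
  assumes arch: "archimedean TYPE('a)" and "0 \<le> e"
    and le: "\<And>\<epsilon>. 0 < \<epsilon> \<Longrightarrow> h \<le> \<epsilon> *\<^sub>R e"
  shows "h \<le> 0"
proof -
  have "real n *\<^sub>R sup h 0 \<le> e" for n
  proof (cases "n = 0")
    case False
    have "sup h 0 \<le> (1 / real n) *\<^sub>R e"
      using False le[of "1 / real n"] \<open>0 \<le> e\<close> by (auto intro: scaleR_nonneg_nonneg)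
    then have "real n *\<^sub>R sup h 0 \<le> real n *\<^sub>R ((1 / real n) *\<^sub>R e)"
      by (intro scaleR_left_mono) auto
    with False show ?thesis by simp
  qed (use \<open>0 \<le> e\<close> in simp)
  then have "sup h 0 = 0"
    using arch \<open>0 \<le> e\<close> unfolding archimedean_def by (metis sup_ge2)
  then show ?thesis
    by (metis sup_ge1)
qed

lemma riesz_hom_mono:
  assumes "riesz_hom u" "f \<le> g"
  shows "u f \<le> (u g :: real)"
  using assms unfolding riesz_hom_def by (metis le_iff_sup)

lemma spectrum_strong_unit:
  fixes e :: "'a::riesz_space"
  assumes "0 < e" "strong_unit e" and star: "\<And>f. 0 \<le> f \<Longrightarrow> star f = inf e f"
  shows "spectrum star = {u. riesz_hom u \<and> u e = 1}"
proof (intro set_eqI iffI)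
  fix u :: "'a \<Rightarrow> real" assume "u \<in> spectrum star"
  then have hom: "riesz_hom u" and nz: "u \<noteq> (\<lambda>_. 0)"
    and trunc: "\<And>f. 0 \<le> f \<Longrightarrow> u (star f) = min 1 (u f)"
    by (auto simp: spectrum_def)
  have lin: "linear u" using hom by (simp add: riesz_hom_def)
  have "0 \<le> e" using \<open>0 < e\<close> by simp
  have "e \<le> 2 *\<^sub>R e"
    using \<open>0 \<le> e\<close> by (simp add: scaleR_2)
  \<comment> \<open>Since \<open>2 e\<close> truncates to \<open>e\<close>, this equation holds; it leaves only the values \<open>0\<close> and \<open>1\<close>.\<close>
  then have "u e = min 1 (2 * u e)"
    using trunc[of "2 *\<^sub>R e"] star[of "2 *\<^sub>R e"] \<open>0 \<le> e\<close> lin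
    by (metis inf.absorb1 linear_cmul order_trans real_scaleR_def)
  moreover have "u e \<noteq> 0"
  proof
    assume "u e = 0"
    have "u f = 0" for f
    proof -
      obtain r where "sup f (- f) \<le> r *\<^sub>R e"
        using \<open>strong_unit e\<close> unfolding strong_unit_def by blast
      then have "u f \<le> u (r *\<^sub>R e)" "u (- f) \<le> u (r *\<^sub>R e)"
        using hom by (auto intro: riesz_hom_mono)
      then show ?thesis
        using lin \<open>u e = 0\<close> by (simp add: linear_cmul linear_neg)
    qed
    with nz show False by blast
  qed
  ultimately show "u \<in> {u. riesz_hom u \<and> u e = 1}"
    using hom by auto
next
  fix u :: "'a \<Rightarrow> real" assume "u \<in> {u. riesz_hom u \<and> u e = 1}"
  then show "u \<in> spectrum star"
    using star by (auto simp: spectrum_def riesz_hom_def inf_real_def)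
qed

section \<open>Nonpositivity cones and homomorphisms\<close>

definition nonpositivity_cone :: "'a::riesz_space \<Rightarrow> 'a set \<Rightarrow> bool" where
  "nonpositivity_cone e W \<longleftrightarrow> 0 \<in> W \<and> e \<notin> W \<and>
     (\<forall>f\<in>W. \<forall>g\<in>W. f + g \<in> W) \<and> (\<forall>c\<ge>0. \<forall>f\<in>W. c *\<^sub>R f \<in> W) \<and>
     (\<forall>g\<in>W. \<forall>f\<le>g. f \<in> W) \<and> (\<forall>f\<in>W. \<forall>g\<in>W. sup f g \<in> W)"

lemma nonpositivity_coneD:
  assumes "nonpositivity_cone e W"
  shows "0 \<in> W" "e \<notin> W" "f \<in> W \<Longrightarrow> g \<in> W \<Longrightarrow> f + g \<in> W"
    "0 \<le> c \<Longrightarrow> f \<in> W \<Longrightarrow> c *\<^sub>R f \<in> W" "g \<in> W \<Longrightarrow> f \<le> g \<Longrightarrow> f \<in> W"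
    "f \<in> W \<Longrightarrow> g \<in> W \<Longrightarrow> sup f g \<in> W"
  using assms unfolding nonpositivity_cone_def by blast+

definition maximal_cone :: "'a::riesz_space \<Rightarrow> 'a set \<Rightarrow> bool" where
  "maximal_cone e W \<longleftrightarrow> nonpositivity_cone e W \<and>
     (\<forall>V. nonpositivity_cone e V \<longrightarrow> W \<subseteq> V \<longrightarrow> V = W)"

lemma ex_maximal_cone:
  assumes "nonpositivity_cone e W"
  obtains M where "maximal_cone e M" "W \<subseteq> M"
proof -
  define A where "A = {V. nonpositivity_cone e V \<and> W \<subseteq> V}"
  have "\<exists>M\<in>A. \<forall>V\<in>A. M \<subseteq> V \<longrightarrow> V = M"
  proof (rule subset_Zorn_nonempty)
    show "A \<noteq> {}" using assms by (auto simp: A_def)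
  next
    fix C assume "C \<noteq> {}" and chain: "subset.chain A C"
    then have cone: "\<And>V. V \<in> C \<Longrightarrow> nonpositivity_cone e V \<and> W \<subseteq> V"
      by (auto simp: A_def subset.chain_def)
    have common: "\<exists>V\<in>C. f \<in> V \<and> g \<in> V" if "f \<in> \<Union>C" "g \<in> \<Union>C" for f g
      using that chain unfolding subset_chain_def by blast
    have "nonpositivity_cone e (\<Union>C)"
      unfolding nonpositivity_cone_def
    proof (intro conjI ballI allI impI)
      show "0 \<in> \<Union>C" using \<open>C \<noteq> {}\<close> cone nonpositivity_coneD(1) by blast
      show "e \<notin> \<Union>C" using cone nonpositivity_coneD(2) by blast
      show "f + g \<in> \<Union>C" "sup f g \<in> \<Union>C" if "f \<in> \<Union>C" "g \<in> \<Union>C" for f g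
        using common[OF that] cone nonpositivity_coneD(3,6) by blast+
      show "c *\<^sub>R f \<in> \<Union>C" if "0 \<le> c" "f \<in> \<Union>C" for c f
        using that cone nonpositivity_coneD(4) by blast
      show "f \<in> \<Union>C" if "g \<in> \<Union>C" "f \<le> g" for f g
        using that cone nonpositivity_coneD(5) by blast
    qed
    moreover have "W \<subseteq> \<Union>C"
      using \<open>C \<noteq> {}\<close> cone by blast
    ultimately show "\<Union>C \<in> A"
      by (simp add: A_def)
  qed
  then obtain M where "M \<in> A" and max: "\<And>V. V \<in> A \<Longrightarrow> M \<subseteq> V \<Longrightarrow> V = M"
    by blast
  show ?thesis
  proof (rule that)
    show "W \<subseteq> M" using \<open>M \<in> A\<close> by (simp add: A_def)
    then show "maximal_cone e M"
      using \<open>M \<in> A\<close> max unfolding maximal_cone_def A_def by blast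
  qed
qed

text \<open>Adding all limits along \<open>e\<close> keeps \<open>e\<close> outside the cone, because cones contain \<open>e\<close> as soon as
  they contain \<open>e - e/2\<close>; so a maximal cone already contains these limits.\<close>

lemma maximal_cone_closed:
  assumes max: "maximal_cone e W" and "0 \<le> e"
    and lim: "\<And>\<epsilon>. 0 < \<epsilon> \<Longrightarrow> g - \<epsilon> *\<^sub>R e \<in> W"
  shows "g \<in> W"
proof -
  have cone: "nonpositivity_cone e W" using max by (simp add: maximal_cone_def)
  note W = nonpositivity_coneD[OF cone]
  define V where "V = {g. \<forall>\<epsilon>>0. g - \<epsilon> *\<^sub>R e \<in> W}"
  have sub: "W \<subseteq> V"
  proof
    fix f assume "f \<in> W"
    have "f - \<epsilon> *\<^sub>R e \<le> f" if "0 < \<epsilon>" for \<epsilon>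
      using that \<open>0 \<le> e\<close> by (simp add: scaleR_nonneg_nonneg)
    then show "f \<in> V" using W(5)[OF \<open>f \<in> W\<close>] by (simp add: V_def)
  qed
  have "nonpositivity_cone e V"
    unfolding nonpositivity_cone_def
  proof (intro conjI ballI allI impI)
    show "0 \<in> V" using sub W(1) by blast
    show "e \<notin> V"
    proof
      assume "e \<in> V"
      then have "e - (1/2) *\<^sub>R e \<in> W" by (simp add: V_def)
      then have "2 *\<^sub>R (e - (1/2) *\<^sub>R e) \<in> W" by (intro W(4)) auto
      then show False using W(2) by (simp add: scaleR_right_diff_distrib scaleR_2)
    qed
    show "f + h \<in> V" if "f \<in> V" "h \<in> V" for f h
      unfolding V_def
    proof (intro CollectI allI impI)
      fix \<epsilon> :: real assume "0 < \<epsilon>"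
      then have "(f - (\<epsilon>/2) *\<^sub>R e) + (h - (\<epsilon>/2) *\<^sub>R e) \<in> W"
        using that by (intro W(3)) (auto simp: V_def)
      moreover have "(f - (\<epsilon>/2) *\<^sub>R e) + (h - (\<epsilon>/2) *\<^sub>R e) = f + h - \<epsilon> *\<^sub>R e"
        by (simp add: algebra_simps flip: scaleR_left_distrib)
      ultimately show "f + h - \<epsilon> *\<^sub>R e \<in> W" by simp
    qed
    show "c *\<^sub>R f \<in> V" if "0 \<le> c" "f \<in> V" for c f
    proof (cases "c = 0")
      case True
      then show ?thesis using \<open>0 \<in> V\<close> by simp
    next
      case False
      show ?thesis
        unfolding V_def
      proof (intro CollectI allI impI)
        fix \<epsilon> :: real assume "0 < \<epsilon>"
        then have "c *\<^sub>R (f - (\<epsilon>/c) *\<^sub>R e) \<in> W"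
          using that False by (intro W(4)) (auto simp: V_def)
        then show "c *\<^sub>R f - \<epsilon> *\<^sub>R e \<in> W"
          using False by (simp add: scaleR_right_diff_distrib)
      qed
    qed
    show "f \<in> V" if "h \<in> V" "f \<le> h" for f h
      using that(1) W(5)[OF _ diff_right_mono[OF that(2)]] by (simp add: V_def)
    show "sup f h \<in> V" if "f \<in> V" "h \<in> V" for f h
    proof -
      have "sup f h - \<epsilon> *\<^sub>R e = sup (f - \<epsilon> *\<^sub>R e) (h - \<epsilon> *\<^sub>R e)" for \<epsilon>
        using sup_add_right[of f h "- (\<epsilon> *\<^sub>R e)"] by simp
      then show ?thesis using that W(6) by (simp add: V_def)
    qed
  qed
  with max sub have "V = W" by (simp add: maximal_cone_def)
  with lim show ?thesis by (auto simp: V_def)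
qed

text \<open>Read in terms of points: if \<open>f \<le> 0\<close> everywhere, then either the condition \<open>f = 0\<close> may be
  imposed, which a maximal cone has already done, or \<open>f\<close> is bounded away from \<open>0\<close>. Imposing the
  condition means enlarging the cone by \<open>- f\<close>.\<close>

lemma maximal_cone_dichotomy:
  assumes max: "maximal_cone e W" and "f \<in> W"
  shows "- f \<in> W \<or> (\<exists>\<delta>>0. f + \<delta> *\<^sub>R e \<in> W)"
proof -
  have cone: "nonpositivity_cone e W" using max by (simp add: maximal_cone_def)
  note W = nonpositivity_coneD[OF cone]
  define V where "V = {g. \<exists>t\<ge>0. g + t *\<^sub>R f \<in> W}"
  have raise: "g + t *\<^sub>R f \<in> W" if "g + s *\<^sub>R f \<in> W" "s \<le> t" for g s t
  proof -
    have "(g + s *\<^sub>R f) + (t - s) *\<^sub>R f \<in> W"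
      using that W(3)[OF _ W(4)[OF _ \<open>f \<in> W\<close>]] by simp
    then show ?thesis by (simp add: scaleR_left_diff_distrib)
  qed
  have sub: "W \<subseteq> V" unfolding V_def by (auto intro!: exI[of _ 0])
  have neg: "- f \<in> V" unfolding V_def using W(1) by (auto intro!: exI[of _ 1])
  show ?thesis
  proof (cases "e \<in> V")
    case True
    then obtain t where "0 \<le> t" "e + t *\<^sub>R f \<in> W" by (auto simp: V_def)
    then have "t \<noteq> 0" using W(2) by auto
    with \<open>0 \<le> t\<close> have "0 < 1 / t" by simp
    have "(1 / t) *\<^sub>R (e + t *\<^sub>R f) \<in> W"
      using \<open>0 < 1 / t\<close> \<open>e + t *\<^sub>R f \<in> W\<close> by (intro W(4)) auto
    then have "f + (1 / t) *\<^sub>R e \<in> W"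
      using \<open>t \<noteq> 0\<close> by (simp add: scaleR_right_distrib add.commute)
    with \<open>0 < 1 / t\<close> show ?thesis by blast
  next
    case False
    have "nonpositivity_cone e V"
      unfolding nonpositivity_cone_def
    proof (intro conjI ballI allI impI)
      show "0 \<in> V" using sub W(1) by blast
      show "e \<notin> V" by fact
      show "g + h \<in> V" "sup g h \<in> V" if "g \<in> V" "h \<in> V" for g h
      proof -
        from that obtain s t where "0 \<le> s" "g + s *\<^sub>R f \<in> W" "0 \<le> t" "h + t *\<^sub>R f \<in> W"
          by (auto simp: V_def)
        then have "g + max s t *\<^sub>R f \<in> W" "h + max s t *\<^sub>R f \<in> W"
          using raise[of g s "max s t"] raise[of h t "max s t"] by simp_all
        then have st: "(g + s *\<^sub>R f) + (h + t *\<^sub>R f) \<in> W"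
            "sup (g + max s t *\<^sub>R f) (h + max s t *\<^sub>R f) \<in> W"
          using W(3)[OF \<open>g + s *\<^sub>R f \<in> W\<close> \<open>h + t *\<^sub>R f \<in> W\<close>] by (blast intro: W(6))+
        have "(g + s *\<^sub>R f) + (h + t *\<^sub>R f) = g + h + (s + t) *\<^sub>R f"
          by (simp add: algebra_simps)
        then show "g + h \<in> V"
          using st(1) \<open>0 \<le> s\<close> \<open>0 \<le> t\<close> unfolding V_def
          by (metis (mono_tags, lifting) add_nonneg_nonneg mem_Collect_eq)
        show "sup g h \<in> V"
          using st(2) \<open>0 \<le> s\<close> unfolding V_def sup_add_right[symmetric]
          by (auto intro!: exI[of _ "max s t"])
      qed
      show "c *\<^sub>R g \<in> V" if "0 \<le> c" "g \<in> V" for c g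
      proof -
        from that obtain t where "0 \<le> t" "g + t *\<^sub>R f \<in> W" by (auto simp: V_def)
        then have "c *\<^sub>R (g + t *\<^sub>R f) \<in> W" using \<open>0 \<le> c\<close> by (intro W(4))
        then show ?thesis
          using \<open>0 \<le> c\<close> \<open>0 \<le> t\<close> unfolding V_def
          by (auto simp: scaleR_right_distrib intro!: exI[of _ "c * t"])
      qed
      show "g \<in> V" if "h \<in> V" "g \<le> h" for g h
        using that(1) W(5)[OF _ add_right_mono[OF that(2)]] by (auto simp: V_def)
    qed
    with max sub have "V = W" by (simp add: maximal_cone_def)
    with neg show ?thesis by blast
  qed
qed

text \<open>The least \<open>s\<close> with \<open>f - s e \<in> W\<close> exists since \<open>W\<close> is closed along \<open>e\<close>. By minimality
  \<open>f - s e\<close> is not bounded away from \<open>0\<close>, so the dichotomy puts \<open>s e - f\<close> into \<open>W\<close> as well. Thus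
  \<open>s\<close> is the unique number for which \<open>f\<close> and \<open>s e\<close> agree modulo the subspace \<open>W \<inter> - W\<close>,
  and this symmetric description makes \<open>s\<close> depend on \<open>f\<close> as a Riesz homomorphism.\<close>

lemma maximal_cone_induces_hom:
  fixes e :: "'a::riesz_space"
  assumes max: "maximal_cone e W" and unit: "strong_unit e"
  obtains u :: "'a \<Rightarrow> real" where "riesz_hom u" "u e = 1" "\<And>f. f \<in> W \<Longrightarrow> u f \<le> 0"
proof -
  have cone: "nonpositivity_cone e W" using max by (simp add: maximal_cone_def)
  note W = nonpositivity_coneD[OF cone]
  have "0 \<le> e" using unit by (simp add: strong_unit_def)
  have pos_mult: "t \<le> 0" if "t *\<^sub>R e \<in> W" for t
  proof (rule ccontr)
    assume "\<not> t \<le> 0"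
    then have "(1 / t) *\<^sub>R (t *\<^sub>R e) \<in> W" using W(4)[OF _ that, of "1 / t"] by simp
    with \<open>\<not> t \<le> 0\<close> W(2) show False by simp
  qed
  have le: "s \<le> t" if "s *\<^sub>R e - f \<in> W" "f - t *\<^sub>R e \<in> W" for s t f
    using pos_mult[of "s - t"] W(3)[OF that] by (simp add: scaleR_left_diff_distrib)
  have ex: "\<exists>s. f - s *\<^sub>R e \<in> W \<and> s *\<^sub>R e - f \<in> W" for f
  proof -
    define T where "T = {t. f - t *\<^sub>R e \<in> W}"
    obtain r where "sup f (- f) \<le> r *\<^sub>R e"
      using unit unfolding strong_unit_def by blast
    then have "f - r *\<^sub>R e \<le> 0" and "(- r) *\<^sub>R e - f \<le> 0"
      using minus_le_iff[of f "r *\<^sub>R e"] by simp_all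
    then have r: "f - r *\<^sub>R e \<in> W" "(- r) *\<^sub>R e - f \<in> W"
      using W(1,5) by blast+
    have "r \<in> T" using r by (simp add: T_def)
    have bdd: "bdd_below T"
      by (rule bdd_belowI[of _ "- r"]) (use le[OF r(2)] in \<open>auto simp: T_def\<close>)
    have up: "t \<in> T" if "s \<in> T" "s \<le> t" for s t
      using that W(5) \<open>0 \<le> e\<close> unfolding T_def
      by (metis (mono_tags, lifting) diff_left_mono mem_Collect_eq scaleR_right_mono)
    have "f - Inf T *\<^sub>R e \<in> W"
    proof (rule maximal_cone_closed[OF max \<open>0 \<le> e\<close>])
      fix \<epsilon> :: real assume "0 < \<epsilon>"
      then obtain t where "t \<in> T" "t < Inf T + \<epsilon>"
        using cInf_lessD[of T "Inf T + \<epsilon>"] \<open>r \<in> T\<close> by auto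
      then have "Inf T + \<epsilon> \<in> T" using up by simp
      then show "f - Inf T *\<^sub>R e - \<epsilon> *\<^sub>R e \<in> W"
        by (simp add: T_def algebra_simps)
    qed
    moreover have False if "0 < \<delta>" "f - Inf T *\<^sub>R e + \<delta> *\<^sub>R e \<in> W" for \<delta>
    proof -
      have "Inf T - \<delta> \<in> T" using that(2) by (simp add: T_def algebra_simps)
      then have "Inf T \<le> Inf T - \<delta>" using bdd by (rule cInf_lower)
      with \<open>0 < \<delta>\<close> show False by simp
    qed
    ultimately show ?thesis
      using maximal_cone_dichotomy[OF max, of "f - Inf T *\<^sub>R e"] by fastforce
  qed
  then obtain u where u: "\<And>f. f - u f *\<^sub>R e \<in> W" "\<And>f. u f *\<^sub>R e - f \<in> W"
    by metis
  have eqI: "u f = s" if "f - s *\<^sub>R e \<in> W" "s *\<^sub>R e - f \<in> W" for f s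
    using le[OF u(2) that(1)] le[OF that(2) u(1)] by simp
  have add: "u (f + g) = u f + u g" for f g
    using W(3)[OF u(1)[of f] u(1)[of g]] W(3)[OF u(2)[of f] u(2)[of g]]
    by (intro eqI) (simp_all add: algebra_simps)
  have neg: "u (- f) = - u f" for f
    using u[of f] by (intro eqI) simp_all
  have scale_nonneg: "u (c *\<^sub>R f) = c * u f" if "0 \<le> c" for c f
    using W(4)[OF that u(1)[of f]] W(4)[OF that u(2)[of f]]
    by (intro eqI) (simp_all add: scaleR_right_diff_distrib)
  have scale: "u (c *\<^sub>R f) = c * u f" for c f
    using scale_nonneg[of c f] scale_nonneg[of "- c" f] neg[of "(- c) *\<^sub>R f"]
    by (cases "0 \<le> c") auto
  have "linear u"
    by (rule linearI) (simp_all add: add scale)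
  have sup: "u (sup f g) = max (u f) (u g)" for f g
  proof (rule eqI)
    define m where "m = max (u f) (u g)"
    have "f - m *\<^sub>R e \<le> f - u f *\<^sub>R e" "g - m *\<^sub>R e \<le> g - u g *\<^sub>R e"
      using \<open>0 \<le> e\<close> by (auto simp: m_def intro: scaleR_right_mono)
    then have "sup (f - m *\<^sub>R e) (g - m *\<^sub>R e) \<in> W"
      using u(1) by (blast intro: W(5,6))
    then show "sup f g - m *\<^sub>R e \<in> W"
      using sup_add_right[of f g "- (m *\<^sub>R e)"] by simp
    have "m *\<^sub>R e - sup f g \<le> m *\<^sub>R e - f" "m *\<^sub>R e - sup f g \<le> m *\<^sub>R e - g"
      by (auto intro: diff_left_mono)
    then show "m *\<^sub>R e - sup f g \<in> W"
      using u(2)[of f] u(2)[of g] W(5) unfolding m_def max_def by metis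
  qed
  have inf: "u (inf f g) = min (u f) (u g)" for f g
  proof -
    have "u (inf f g) = u (- sup (- f) (- g))" by (simp add: uminus_sup)
    also have "\<dots> = - max (- u f) (- u g)" by (simp only: neg sup)
    finally show ?thesis by linarith
  qed
  have "riesz_hom u"
    unfolding riesz_hom_def using \<open>linear u\<close> sup inf by (simp add: sup_real_def inf_real_def)
  moreover have "u e = 1"
    using W(1) by (intro eqI) auto
  moreover have "u f \<le> 0" if "f \<in> W" for f
    using le[of "u f" f 0] u(2)[of f] that by simp
  ultimately show ?thesis using that by blast
qed

text \<open>The cone generated by \<open>s e - f \<ge> 0\<close> forces \<open>u f \<ge> s\<close>. It avoids \<open>e\<close> because \<open>e \<le> t (s e - f)\<close>
  would give \<open>f \<le> (s - 1/t) e\<close>, against the choice of \<open>s\<close> as the least bound.\<close>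

lemma ex_hom_attaining_least_bound:
  fixes e f :: "'a::riesz_space"
  assumes "0 < e" and unit: "strong_unit e"
    and bound: "f \<le> s *\<^sub>R e" and least: "\<And>t. f \<le> t *\<^sub>R e \<Longrightarrow> s \<le> t"
  obtains u :: "'a \<Rightarrow> real" where "riesz_hom u" "u e = 1" "s \<le> u f"
proof -
  define d where "d = s *\<^sub>R e - f"
  have "0 \<le> d" using bound by (simp add: d_def)
  define W where "W = {g. \<exists>t\<ge>0. g \<le> t *\<^sub>R d}"
  have "e \<notin> W"
  proof
    assume "e \<in> W"
    then obtain t where t: "0 \<le> t" "e \<le> t *\<^sub>R d" by (auto simp: W_def)
    then have "t \<noteq> 0" using \<open>0 < e\<close> by auto
    have "(1 / t) *\<^sub>R e \<le> (1 / t) *\<^sub>R (t *\<^sub>R d)"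
      using t by (intro scaleR_left_mono) auto
    then have "(1 / t) *\<^sub>R e \<le> d" using \<open>t \<noteq> 0\<close> by simp
    then have "f \<le> (s - 1 / t) *\<^sub>R e"
      by (simp add: d_def scaleR_left_diff_distrib algebra_simps)
    then have "s \<le> s - 1 / t" by (rule least)
    with t(1) \<open>t \<noteq> 0\<close> show False by simp
  qed
  have "nonpositivity_cone e W"
    unfolding nonpositivity_cone_def
  proof (intro conjI ballI allI impI)
    show "0 \<in> W" by (auto simp: W_def intro!: exI[of _ 0])
    show "e \<notin> W" by fact
    show "g + h \<in> W" "sup g h \<in> W" if "g \<in> W" "h \<in> W" for g h
    proof -
      from that obtain a b where ab: "0 \<le> a" "g \<le> a *\<^sub>R d" "0 \<le> b" "h \<le> b *\<^sub>R d"
        by (auto simp: W_def)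
      have "g + h \<le> (a + b) *\<^sub>R d"
        using ab by (simp add: scaleR_left_distrib add_mono)
      then show "g + h \<in> W" using ab by (auto simp: W_def intro!: exI[of _ "a + b"])
      have "a *\<^sub>R d \<le> max a b *\<^sub>R d" "b *\<^sub>R d \<le> max a b *\<^sub>R d"
        using \<open>0 \<le> d\<close> by (auto intro: scaleR_right_mono)
      then have "sup g h \<le> max a b *\<^sub>R d"
        using ab by (meson order_trans sup_least)
      then show "sup g h \<in> W" using ab by (auto simp: W_def intro!: exI[of _ "max a b"])
    qed
    show "c *\<^sub>R g \<in> W" if "0 \<le> c" "g \<in> W" for c g
    proof -
      from that obtain t where "0 \<le> t" "g \<le> t *\<^sub>R d" by (auto simp: W_def)
      then have "c *\<^sub>R g \<le> (c * t) *\<^sub>R d"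
        using scaleR_left_mono[of g "t *\<^sub>R d" c] \<open>0 \<le> c\<close> by simp
      then show ?thesis using \<open>0 \<le> c\<close> \<open>0 \<le> t\<close> by (auto simp: W_def intro!: exI[of _ "c * t"])
    qed
    show "g \<in> W" if "h \<in> W" "g \<le> h" for g h
      using that by (auto simp: W_def intro: order_trans)
  qed
  then obtain M where M: "maximal_cone e M" "W \<subseteq> M" by (rule ex_maximal_cone)
  obtain u :: "'a \<Rightarrow> real" where u: "riesz_hom u" "u e = 1" "\<And>g. g \<in> M \<Longrightarrow> u g \<le> 0"
    using maximal_cone_induces_hom[OF M(1) unit] by blast
  have "d \<in> M" using M(2) by (auto simp: W_def intro!: exI[of _ 1])
  then have "u (s *\<^sub>R e - f) \<le> 0" using u(3) by (simp add: d_def)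
  moreover have "linear u" using u(1) by (simp add: riesz_hom_def)
  ultimately have "s \<le> u f" using u(2) by (simp add: linear_diff linear_cmul)
  with u that show ?thesis by blast
qed

text \<open>The infimum \<open>s\<close> of the numbers \<open>t\<close> with \<open>\<bar>f\<bar> \<le> t e\<close> is again such a number because the space is
  Archimedean, and \<open>s = 0\<close> would force \<open>f = 0\<close>. Hence a homomorphism with \<open>u \<bar>f\<bar> \<ge> s\<close> does not
  vanish at \<open>f\<close>.\<close>

lemma homs_separate_from_0:
  fixes e f :: "'a::riesz_space"
  assumes arch: "archimedean TYPE('a)" and "0 < e" and unit: "strong_unit e" and "f \<noteq> 0"
  obtains u :: "'a \<Rightarrow> real" where "riesz_hom u" "u e = 1" "u f \<noteq> 0"
proof -
  have "0 \<le> e" using \<open>0 < e\<close> by simp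
  define a where "a = sup f (- f)"
  have "\<not> a \<le> 0" using \<open>f \<noteq> 0\<close> by (simp add: a_def sup_uminus_eq_0_iff del: le_sup_iff)
  define T where "T = {t. a \<le> t *\<^sub>R e}"
  have nonneg: "0 \<le> t" if "t \<in> T" for t
  proof -
    have "- t *\<^sub>R e \<le> - f" "- t *\<^sub>R e \<le> f"
      using that minus_le_iff[of f "t *\<^sub>R e"] by (simp_all add: T_def a_def)
    then have "(- t) *\<^sub>R e \<le> a" by (simp add: a_def le_supI1)
    then have "(- t) *\<^sub>R e \<le> t *\<^sub>R e" using that unfolding T_def by (metis order_trans mem_Collect_eq)
    then show ?thesis using scaleR_le_iff_of_pos[OF \<open>0 < e\<close>, of "- t" t] by simp
  qed
  then have bdd: "bdd_below T" by (rule bdd_belowI)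
  obtain r where "r \<in> T"
    using unit unfolding strong_unit_def T_def a_def by blast
  have up: "t \<in> T" if "s \<in> T" "s \<le> t" for s t
    using that \<open>0 \<le> e\<close> scaleR_right_mono[of s t e] unfolding T_def by auto
  define s where "s = Inf T"
  have "a - s *\<^sub>R e \<le> 0"
  proof (rule archimedean_le_0[OF arch \<open>0 \<le> e\<close>])
    fix \<epsilon> :: real assume "0 < \<epsilon>"
    then obtain t where "t \<in> T" "t < s + \<epsilon>"
      using cInf_lessD[of T "s + \<epsilon>"] \<open>r \<in> T\<close> by (auto simp: s_def)
    then have "s + \<epsilon> \<in> T" using up by simp
    then show "a - s *\<^sub>R e \<le> \<epsilon> *\<^sub>R e" by (simp add: T_def algebra_simps)
  qed
  then have "a \<le> s *\<^sub>R e" by simp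
  then have "s \<in> T" by (simp add: T_def)
  have "s \<noteq> 0" using \<open>a \<le> s *\<^sub>R e\<close> \<open>\<not> a \<le> 0\<close> by auto
  with nonneg[OF \<open>s \<in> T\<close>] have "0 < s" by simp
  have "\<And>t. a \<le> t *\<^sub>R e \<Longrightarrow> s \<le> t"
    using cInf_lower[OF _ bdd] by (simp add: T_def s_def)
  then obtain u :: "'a \<Rightarrow> real" where u: "riesz_hom u" "u e = 1" "s \<le> u a"
    using ex_hom_attaining_least_bound[OF \<open>0 < e\<close> unit \<open>a \<le> s *\<^sub>R e\<close>] by blast
  have "u a = max (u f) (- u f)"
    using u(1) by (simp add: riesz_hom_def a_def sup_real_def linear_neg)
  with u \<open>0 < s\<close> have "u f \<noteq> 0" by auto
  with u that show ?thesis by blast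
qed

section \<open>Compactness of the spectrum\<close>

lemma compact_unital_homs:
  fixes e :: "'a::riesz_space"
  assumes unit: "strong_unit e"
  shows "compact {u :: 'a \<Rightarrow> real. riesz_hom u \<and> u e = 1}" (is "compact ?X")
proof -
  obtain r where r: "\<And>f. sup f (- f) \<le> r f *\<^sub>R e"
    using unit unfolding strong_unit_def by metis
  have "?X \<subseteq> (\<Pi>\<^sub>E f\<in>UNIV. {- r f..r f})"
  proof
    fix u assume "u \<in> ?X"
    then have u: "riesz_hom u" "u e = 1" "linear u" by (auto simp: riesz_hom_def)
    have "u f \<le> r f \<and> - r f \<le> u f" for f
    proof -
      have "u f \<le> u (r f *\<^sub>R e)" "u (- f) \<le> u (r f *\<^sub>R e)"
        using r[of f] by (auto intro: riesz_hom_mono[OF u(1)])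
      then show ?thesis using u by (simp add: linear_cmul linear_neg)
    qed
    then show "u \<in> (\<Pi>\<^sub>E f\<in>UNIV. {- r f..r f})" by auto
  qed
  moreover have "compact (\<Pi>\<^sub>E f\<in>UNIV. {- r f..r f})"
  proof -
    have "compactin (product_topology (\<lambda>_. euclidean) UNIV) (\<Pi>\<^sub>E f\<in>UNIV. {- r f..r f})"
      by (simp add: compactin_PiE)
    then show ?thesis by (simp add: euclidean_product_topology)
  qed
  moreover have "closed ?X"
  proof -
    have "?X = {u. \<forall>f g c. u (f + g) = u f + u g \<and> u (c *\<^sub>R f) = c * u f \<and>
        u (sup f g) = max (u f) (u g) \<and> u (inf f g) = min (u f) (u g) \<and> u e = 1}"
      by (auto simp: riesz_hom_def sup_real_def inf_real_def linear_add linear_cmul intro!: linearI)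
    moreover have "closed \<dots>"
      by (intro closed_Collect_all closed_Collect_conj closed_Collect_eq continuous_intros
          continuous_on_product_coordinates)
    ultimately show ?thesis by simp
  qed
  ultimately have "compact ((\<Pi>\<^sub>E f\<in>UNIV. {- r f..r f}) \<inter> ?X)"
    by (intro compact_Int_closed)
  then show ?thesis
    using \<open>?X \<subseteq> (\<Pi>\<^sub>E f\<in>UNIV. {- r f..r f})\<close> by (simp only: inf.absorb2)
qed

section \<open>The lattice form of the Stone--Weierstrass theorem\<close>

text \<open>Finitely many local lower estimates are patched by taking the maximum. The
  predicate \<open>P\<close> carries along an additional property of the approximants.\<close>

lemma patch_lower_estimates:
  fixes S :: "('b::topological_space \<Rightarrow> real) set"
  assumes "compact X" "X \<noteq> {}" and h: "continuous_on X h"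
    and cont: "\<And>\<phi>. \<phi> \<in> S \<Longrightarrow> continuous_on X \<phi>"
    and max: "\<And>\<phi> \<psi>. \<phi> \<in> S \<Longrightarrow> \<psi> \<in> S \<Longrightarrow> (\<lambda>x\<in>X. max (\<phi> x) (\<psi> x)) \<in> S"
    and Pmax: "\<And>\<phi> \<psi>. P \<phi> \<Longrightarrow> P \<psi> \<Longrightarrow> P (\<lambda>x\<in>X. max (\<phi> x) (\<psi> x))"
    and loc: "\<And>y. y \<in> X \<Longrightarrow> \<exists>\<phi>\<in>S. P \<phi> \<and> h y < \<phi> y"
  obtains \<phi> where "\<phi> \<in> S" "P \<phi>" "\<And>x. x \<in> X \<Longrightarrow> h x < \<phi> x"
proof -
  obtain G where G: "\<And>y. y \<in> X \<Longrightarrow> G y \<in> S \<and> P (G y) \<and> h y < G y y"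
    using loc by metis
  have "\<exists>U. open U \<and> U \<inter> X = {x \<in> X. h x < G y x}" if "y \<in> X" for y
  proof -
    have "continuous_on X (\<lambda>x. G y x - h x)"
      using G[OF that] by (intro continuous_on_diff cont h) auto
    then obtain U where "open U" "U \<inter> X = (\<lambda>x. G y x - h x) -` {0<..} \<inter> X"
      using continuous_on_open_invariant open_greaterThan by metis
    then show ?thesis by (intro exI[of _ U]) auto
  qed
  then obtain U where U: "\<And>y. y \<in> X \<Longrightarrow> open (U y) \<and> U y \<inter> X = {x \<in> X. h x < G y x}"
    by metis
  have "X \<subseteq> (\<Union>y\<in>X. U y)" using U G by blast
  then obtain F where F: "F \<subseteq> X" "finite F" "X \<subseteq> (\<Union>y\<in>F. U y)"
    using compactE_image[OF \<open>compact X\<close>, of X U] U by blast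
  have "F \<noteq> {}" using F \<open>X \<noteq> {}\<close> by blast
  from \<open>finite F\<close> this \<open>F \<subseteq> X\<close> have "\<exists>\<phi>\<in>S. P \<phi> \<and> (\<forall>y\<in>F. \<forall>x\<in>X. G y x \<le> \<phi> x)"
  proof (induction F rule: finite_ne_induct)
    case (singleton y)
    then show ?case using G by auto
  next
    case (insert y F)
    then obtain \<phi> where \<phi>: "\<phi> \<in> S" "P \<phi>" "\<forall>z\<in>F. \<forall>x\<in>X. G z x \<le> \<phi> x" by auto
    have "G y \<in> S" "P (G y)" using insert.prems G by auto
    then have "(\<lambda>x\<in>X. max (G y x) (\<phi> x)) \<in> S" "P (\<lambda>x\<in>X. max (G y x) (\<phi> x))"
      using \<phi> by (blast intro: max Pmax)+
    moreover have "\<forall>z\<in>insert y F. \<forall>x\<in>X. G z x \<le> (\<lambda>x\<in>X. max (G y x) (\<phi> x)) x"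
      using \<phi>(3) by (auto simp: le_max_iff_disj)
    ultimately show ?case by blast
  qed
  then obtain \<phi> where \<phi>: "\<phi> \<in> S" "P \<phi>" "\<And>y x. y \<in> F \<Longrightarrow> x \<in> X \<Longrightarrow> G y x \<le> \<phi> x" by blast
  have "h x < \<phi> x" if "x \<in> X" for x
  proof -
    from that F(3) obtain y where "y \<in> F" "x \<in> U y" by blast
    then have "h x < G y x" using U F(1) that by blast
    also have "\<dots> \<le> \<phi> x" using \<phi>(3) \<open>y \<in> F\<close> that .
    finally show ?thesis .
  qed
  with \<phi> that show ?thesis by blast
qed

text \<open>Functions that interpolate \<open>h\<close> at two points are patched twice: for fixed \<open>x\<close>, over the second
  point, to stay above \<open>h - \<epsilon>\<close> while keeping the value \<open>h x\<close> at \<open>x\<close>; then over \<open>x\<close>, to stay below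
  \<open>h + \<epsilon>\<close> too. The second step is the first one applied to negatives.\<close>

theorem lattice_stone_weierstrass:
  fixes X :: "'b::topological_space set"
  assumes "compact X" and S: "riesz_subspace_of_cont_funs X S"
    and one: "(\<lambda>x\<in>X. 1) \<in> S"
    and sep: "\<And>x y. x \<in> X \<Longrightarrow> y \<in> X \<Longrightarrow> x \<noteq> y \<Longrightarrow> \<exists>\<phi>\<in>S. \<phi> x \<noteq> \<phi> y"
  shows "uniformly_dense_in_cont_funs X S"
proof -
  have cont: "\<And>\<phi>. \<phi> \<in> S \<Longrightarrow> continuous_on X \<phi>"
    and add: "\<And>\<phi> \<psi>. \<phi> \<in> S \<Longrightarrow> \<psi> \<in> S \<Longrightarrow> (\<lambda>x\<in>X. \<phi> x + \<psi> x) \<in> S"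
    and scale: "\<And>c \<phi>. \<phi> \<in> S \<Longrightarrow> (\<lambda>x\<in>X. c * \<phi> x) \<in> S"
    and max: "\<And>\<phi> \<psi>. \<phi> \<in> S \<Longrightarrow> \<psi> \<in> S \<Longrightarrow> (\<lambda>x\<in>X. max (\<phi> x) (\<psi> x)) \<in> S"
    and zero: "(\<lambda>x\<in>X. 0) \<in> S" and sub: "S \<subseteq> cont_funs X"
    using S by (auto simp: riesz_subspace_of_cont_funs_def cont_funs_def)
  have interpolate: "\<exists>\<phi>\<in>S. \<phi> x = a \<and> \<phi> y = b"
    if "x \<in> X" "y \<in> X" "x = y \<Longrightarrow> a = b" for x y a b
  proof (cases "x = y")
    case True
    then show ?thesis
      using that by (intro bexI[OF _ scale[OF one, of a]]) simp
  next
    case False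
    then obtain \<psi> where \<psi>: "\<psi> \<in> S" "\<psi> x \<noteq> \<psi> y" using sep \<open>x \<in> X\<close> \<open>y \<in> X\<close> by blast
    define c where "c = (b - a) / (\<psi> y - \<psi> x)"
    define \<phi> where "\<phi> = (\<lambda>z\<in>X. (\<lambda>z\<in>X. c * \<psi> z) z + (\<lambda>z\<in>X. (a - c * \<psi> x) * (\<lambda>z\<in>X. 1) z) z)"
    have "\<phi> \<in> S" unfolding \<phi>_def using \<psi>(1) one by (intro add scale)
    moreover have "\<phi> x = a" using \<open>x \<in> X\<close> by (simp add: \<phi>_def)
    moreover have "\<phi> y = b"
    proof -
      have "\<phi> y = a + c * (\<psi> y - \<psi> x)" using \<open>y \<in> X\<close> by (simp add: \<phi>_def algebra_simps)
      also have "c * (\<psi> y - \<psi> x) = b - a" using \<psi>(2) by (simp add: c_def)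
      finally show ?thesis by simp
    qed
    ultimately show ?thesis by blast
  qed
  have approx: "\<exists>\<phi>\<in>S. \<forall>x\<in>X. \<bar>h x - \<phi> x\<bar> \<le> \<epsilon>" if h: "continuous_on X h" and "0 < \<epsilon>" for h \<epsilon>
  proof (cases "X = {}")
    case True
    then show ?thesis using zero by auto
  next
    case False
    have above: "\<exists>\<phi>\<in>S. \<phi> x = h x \<and> (\<forall>y\<in>X. h y - \<epsilon> < \<phi> y)" if "x \<in> X" for x
    proof -
      have "\<exists>\<phi>\<in>S. \<phi> x = h x \<and> h y - \<epsilon> < \<phi> y" if "y \<in> X" for y
        using interpolate[OF \<open>x \<in> X\<close> that, of "h x" "h y"] \<open>0 < \<epsilon>\<close> by force
      then obtain \<phi> where "\<phi> \<in> S" "\<phi> x = h x" "\<And>y. y \<in> X \<Longrightarrow> h y - \<epsilon> < \<phi> y"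
        by (rule patch_lower_estimates[OF \<open>compact X\<close> False _ cont max,
              where h = "\<lambda>y. h y - \<epsilon>" and P = "\<lambda>\<phi>. \<phi> x = h x", rotated -2])
          (use \<open>x \<in> X\<close> in \<open>auto intro!: continuous_intros h\<close>)
      then show ?thesis by blast
    qed
    have "\<exists>\<phi>\<in>S. (\<forall>y\<in>X. \<phi> y < - h y + \<epsilon>) \<and> - h x - \<epsilon> < \<phi> x" if x: "x \<in> X" for x
    proof -
      from above[OF x] obtain \<phi> where "\<phi> \<in> S" "\<phi> x = h x" "\<forall>y\<in>X. h y - \<epsilon> < \<phi> y" by blast
      then show ?thesis
        using scale[of \<phi> "- 1"] x \<open>0 < \<epsilon>\<close> by (intro bexI[of _ "\<lambda>y\<in>X. - 1 * \<phi> y"]) auto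
    qed
    then obtain \<phi> where \<phi>: "\<phi> \<in> S" "\<forall>y\<in>X. \<phi> y < - h y + \<epsilon>" "\<And>x. x \<in> X \<Longrightarrow> - h x - \<epsilon> < \<phi> x"
      by (rule patch_lower_estimates[OF \<open>compact X\<close> False _ cont max,
            where h = "\<lambda>x. - h x - \<epsilon>" and P = "\<lambda>\<phi>. \<forall>y\<in>X. \<phi> y < - h y + \<epsilon>", rotated -2])
        (auto intro!: continuous_intros h)
    then show ?thesis
      using scale[of \<phi> "- 1"] by (intro bexI[of _ "\<lambda>x\<in>X. - 1 * \<phi> x"]) (force simp: abs_le_iff)+
  qed
  let ?C = "cfunspace (top_of_set X) (euclidean_metric :: real metric)"
  interpret C: Metric_space "mspace ?C" "mdist ?C" by (rule Metric_space_mspace_mdist)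
  have carrier: "mspace ?C = cont_funs X" using \<open>compact X\<close> by (rule mspace_cfunspace_compact)
  show ?thesis
    unfolding uniformly_dense_in_cont_funs_def mtopology_of_def C.metric_closure_of_alt
  proof (intro subsetI CollectI conjI allI impI)
    fix h :: "'b \<Rightarrow> real" and \<epsilon> :: real assume "h \<in> cont_funs X" "0 < \<epsilon>"
    then obtain \<phi> where "\<phi> \<in> S" "\<forall>x\<in>X. \<bar>h x - \<phi> x\<bar> \<le> \<epsilon>"
      using approx[of h \<epsilon>] by (auto simp: cont_funs_def)
    then have "mdist ?C h \<phi> \<le> \<epsilon>"
      using \<open>0 < \<epsilon>\<close> by (intro mdist_cfunspace_le) (auto simp: dist_real_def)
    moreover have "h \<in> mspace ?C" "\<phi> \<in> mspace ?C"
      unfolding carrier using \<open>\<phi> \<in> S\<close> sub \<open>h \<in> cont_funs X\<close> by blast+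
    ultimately have "\<phi> \<in> C.mcball h \<epsilon>"
      by (simp only: C.in_mcball)
    with \<open>\<phi> \<in> S\<close> show "\<exists>\<phi>\<in>S. \<phi> \<in> C.mcball h \<epsilon>" by blast
  qed (rule carrier[THEN equalityD2, THEN subsetD])
qed

section \<open>The representation theorem\<close>

theorem corollary6p1:
  fixes e :: "'a::riesz_space" and star :: "'a \<Rightarrow> 'a"
  assumes "archimedean TYPE('a)"
    and "0 < e" and "strong_unit e"
    and "truncation star" and "\<And>f. 0 \<le> f \<Longrightarrow> star f = inf e f"
  shows "compact (spectrum star) \<and>
    (\<exists>S \<Phi>. riesz_subspace_of_cont_funs (spectrum star) S \<and>
           uniformly_dense_in_cont_funs (spectrum star) S \<and>
           riesz_iso_onto (spectrum star) \<Phi> S \<and>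
           \<Phi> e = (\<lambda>u\<in>spectrum star. 1))"
proof -
  define X where "X = spectrum star"
  have X: "X = {u. riesz_hom u \<and> u e = 1}"
    unfolding X_def using assms(2,3,5) by (rule spectrum_strong_unit)
  have "compact X" unfolding X by (rule compact_unital_homs[OF assms(3)])
  define \<Phi> :: "'a \<Rightarrow> ('a \<Rightarrow> real) \<Rightarrow> real" where "\<Phi> f = (\<lambda>u\<in>X. u f)" for f
  have hom: "linear u" "u (sup f g) = max (u f) (u g)" "u (inf f g) = min (u f) (u g)"
    if "u \<in> X" for u f g
    using that by (auto simp: X riesz_hom_def sup_real_def inf_real_def)
  have \<Phi>_add: "\<Phi> (f + g) = (\<lambda>u\<in>X. \<Phi> f u + \<Phi> g u)"
    and \<Phi>_scale: "\<Phi> (c *\<^sub>R f) = (\<lambda>u\<in>X. c * \<Phi> f u)"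
    and \<Phi>_sup: "\<Phi> (sup f g) = (\<lambda>u\<in>X. max (\<Phi> f u) (\<Phi> g u))"
    and \<Phi>_inf: "\<Phi> (inf f g) = (\<lambda>u\<in>X. min (\<Phi> f u) (\<Phi> g u))" for f g c
    by (auto simp: \<Phi>_def hom linear_add linear_cmul intro!: restrict_ext)
  have \<Phi>_unit: "\<Phi> e = (\<lambda>u\<in>X. 1)"
    by (auto simp: \<Phi>_def X intro!: restrict_ext)
  have \<Phi>_cont: "\<Phi> f \<in> cont_funs X" for f
  proof -
    have "continuous_on X (\<lambda>u. u f)"
      by (rule continuous_on_product_coordinates[THEN continuous_on_subset]) simp
    then have "continuous_on X (\<Phi> f)"
      by (rule continuous_on_eq) (simp add: \<Phi>_def)
    then show ?thesis
      by (simp add: cont_funs_def \<Phi>_def)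
  qed
  have "(\<lambda>u\<in>X. 0) = \<Phi> 0"
    using \<Phi>_scale[of 0 0] by simp
  then have "(\<lambda>u\<in>X. 0) \<in> range \<Phi>"
    by (rule image_eqI) simp
  then have sub: "riesz_subspace_of_cont_funs X (range \<Phi>)"
    unfolding riesz_subspace_of_cont_funs_def
    using \<Phi>_cont by (simp add: image_subset_iff flip: \<Phi>_add \<Phi>_scale \<Phi>_sup \<Phi>_inf)
  have "inj \<Phi>"
  proof (rule injI, rule ccontr)
    fix f g assume eq: "\<Phi> f = \<Phi> g" and "f \<noteq> g"
    then have "f - g \<noteq> 0" by simp
    then obtain u where u: "riesz_hom u" "u e = 1" "u (f - g) \<noteq> (0::real)"
      using homs_separate_from_0[OF assms(1,2,3)] by blast
    then have "u \<in> X" by (simp add: X)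
    with u hom(1)[OF this] fun_cong[OF eq, of u] show False
      by (simp add: \<Phi>_def linear_diff)
  qed
  then have iso: "riesz_iso_onto X \<Phi> (range \<Phi>)"
    unfolding riesz_iso_onto_def bij_betw_def
    by (intro conjI allI refl \<Phi>_add \<Phi>_scale \<Phi>_sup \<Phi>_inf)
  have "uniformly_dense_in_cont_funs X (range \<Phi>)"
  proof (rule lattice_stone_weierstrass[OF \<open>compact X\<close> sub])
    show "(\<lambda>u\<in>X. 1) \<in> range \<Phi>" unfolding \<Phi>_unit[symmetric] by (rule rangeI)
  next
    fix u v assume "u \<in> X" "v \<in> X" "u \<noteq> v"
    then obtain f where "u f \<noteq> v f" by blast
    then show "\<exists>\<phi>\<in>range \<Phi>. \<phi> u \<noteq> \<phi> v"
      using \<open>u \<in> X\<close> \<open>v \<in> X\<close> by (auto simp: \<Phi>_def intro!: exI[of _ f])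
  qed
  with sub iso \<Phi>_unit have "\<exists>S \<Phi>. riesz_subspace_of_cont_funs X S \<and>
      uniformly_dense_in_cont_funs X S \<and> riesz_iso_onto X \<Phi> S \<and> \<Phi> e = (\<lambda>u\<in>X. 1)"
    by (intro exI[of _ "range \<Phi>"] exI[of _ \<Phi>] conjI)
  with \<open>compact X\<close> show ?thesis
    unfolding X_def by (rule conjI)
qed

end
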